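(* Let $n\ge 1$ and put $m_n:=\left\lfloor\frac{n+1}{2}\right\rfloor$. For any two normal matrices $A,B\in M_n(\mathbb{C})$, \[ d(\sigma(A),\sigma(B))^2\le \sum_{k=1}^{m_n}s_k(A-B)^2 . \] Equivalently, \[ d(\sigma(A),\sigma(B))\le \lVert A-B\rVert_{(2,m_n)} . \] In particular, \[ d(\sigma(A),\sigma(B))\le \sqrt{m_n}\,\lVert A-B\rVert . \]
   Context: For normal $A,B\in M_n(\mathbb{C})$ write $\sigma(A)=\{\alpha_1,\ldots,\alpha_n\}$ and $\sigma(B)=\{\beta_1,\ldots,\beta_n\}$ for the spectra, with eigenvalues counted with algebraic multiplicity. The optimal matching distance is \[ d(\sigma(A),\sigma(B))=\min_{\tau\in S_n}\max_{1\le i\le n}|\alpha_i-\beta_{\tau(i)}| , \] where $S_n$ is the group of permutations of $\{1,\ldots,n\}$. For $M\in M_n(\mathbb{C})$, $s_1(M)\ge s_2(M)\ge\cdots\ge s_n(M)\ge 0$ are the singular values of $M$, $\lVert M\rVert=s_1(M)$ is the spectral (operator) norm, and for $1\le r\le n$ the Ky Fan $(2,r)$-norm is $\lVert M\rVert_{(2,r)}:=\left(\sum_{k=1}^r s_k(M)^2\right)^{1/2}$. *)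

theory Defs
  imports
    "Jordan_Normal_Form.Char_Poly"
    "Jordan_Normal_Form.Schur_Decomposition"
    "HOL-Combinatorics.List_Permutation"
begin

definition normal_mat :: "complex mat \<Rightarrow> bool" where
  "normal_mat A \<longleftrightarrow> A * mat_adjoint A = mat_adjoint A * A"

text \<open>The spectrum with eigenvalues counted with algebraic multiplicity.\<close>

definition eigvals :: "complex mat \<Rightarrow> complex multiset" where
  "eigvals A = proots (char_poly A)"

lemma size_eigvals:
  assumes "A \<in> carrier_mat n n"
  shows "size (eigvals A) = n"
proof -
  from char_poly_factorized[OF assms] obtain as where
    as: "char_poly A = (\<Prod>a\<leftarrow>as. [:- a, 1:])" "length as = n" by auto
  have "proots (\<Prod>a\<leftarrow>as. [:- a, 1::complex:]) = mset as"
  proof (induction as)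
    case (Cons a as)
    have "(\<Prod>a\<leftarrow>as. [:- a, 1::complex:]) \<noteq> 0"
      by (induction as) (auto simp del: mult_pCons_left)
    with Cons show ?case
      by (simp add: proots_mult del: mult_pCons_left)
  qed simp
  with as show ?thesis by (simp add: eigvals_def)
qed

definition matching_dist_list :: "complex list \<Rightarrow> complex list \<Rightarrow> real" where
  "matching_dist_list xs ys =
     Min ((\<lambda>\<tau>. Max ((\<lambda>i. cmod (xs ! i - ys ! \<tau> i)) ` {..<length xs}))
       ` {\<tau>. \<tau> permutes {..<length xs}})"

text \<open>The multisets are meant to have the same size; the value then does not depend on the
  chosen enumerations (lemma \<open>opt_matching_dist_eq\<close> below).\<close>

definition opt_matching_dist :: "complex multiset \<Rightarrow> complex multiset \<Rightarrow> real" where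
  "opt_matching_dist S T =
     matching_dist_list (SOME xs. mset xs = S) (SOME ys. mset ys = T)"

lemma matching_dist_list_cong_left:
  assumes "mset xs' = mset xs" "length ys = length xs"
  shows "matching_dist_list xs' ys = matching_dist_list xs ys"
proof -
  let ?I = "{..<length xs}"
  from mset_eq_permutation[OF assms(1)[symmetric]] obtain q where
    "q permutes {..<length xs'}" "permute_list q xs' = xs" by metis
  moreover from mset_eq_permutation[OF assms(1)] obtain p where
    p: "p permutes ?I" "permute_list p xs = xs'" by metis
  ultimately have len: "length xs' = length xs" by auto
  have nth: "xs' ! i = xs ! p i" if "i < length xs" for i
    using p that by (auto simp: permute_list_nth)
  have img: "p ` ?I = ?I" by (rule permutes_image[OF p(1)])
  have eq: "(\<lambda>i. cmod (xs' ! i - ys ! (\<tau> \<circ> p) i)) ` ?I = (\<lambda>i. cmod (xs ! i - ys ! \<tau> i)) ` ?I" for \<tau>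
  proof -
    have "(\<lambda>i. cmod (xs ! i - ys ! \<tau> i)) ` ?I = (\<lambda>i. cmod (xs ! i - ys ! \<tau> i)) ` p ` ?I"
      using img by simp
    also have "\<dots> = (\<lambda>i. cmod (xs' ! i - ys ! (\<tau> \<circ> p) i)) ` ?I"
      unfolding image_image by (intro image_cong) (auto simp: nth)
    finally show ?thesis by simp
  qed
  have perms: "{\<tau>. \<tau> permutes ?I} = (\<lambda>\<tau>. \<tau> \<circ> p) ` {\<tau>. \<tau> permutes ?I}"
  proof -
    have "\<tau> = (\<tau> \<circ> inv_into UNIV p) \<circ> p" for \<tau> :: "nat \<Rightarrow> nat"
      by (simp add: o_assoc[symmetric] permutes_inv_o[OF p(1)])
    moreover have "\<tau> \<circ> inv_into UNIV p permutes ?I" if "\<tau> permutes ?I" for \<tau>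
      using that p(1) by (simp add: permutes_compose permutes_inv)
    ultimately have "\<tau> \<in> (\<lambda>\<tau>. \<tau> \<circ> p) ` {\<tau>. \<tau> permutes ?I}" if "\<tau> permutes ?I" for \<tau>
      using that by blast
    moreover have "\<tau> \<circ> p permutes ?I" if "\<tau> permutes ?I" for \<tau>
      using permutes_compose[OF p(1) that] .
    ultimately show ?thesis by blast
  qed
  show ?thesis
    unfolding matching_dist_list_def len
    by (subst perms) (simp only: image_image eq)
qed

lemma matching_dist_list_cong_right:
  assumes "mset ys' = mset ys" "length ys = length xs"
  shows "matching_dist_list xs ys' = matching_dist_list xs ys"
proof -
  let ?I = "{..<length xs}"
  from mset_eq_permutation[OF assms(1)] assms(2) obtain p where
    p: "p permutes ?I" "permute_list p ys = ys'" by metis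
  have nth: "ys' ! i = ys ! p i" if "i < length xs" for i
    using p that assms(2) by (auto simp: permute_list_nth)
  have eq: "(\<lambda>i. cmod (xs ! i - ys' ! \<tau> i)) ` ?I = (\<lambda>i. cmod (xs ! i - ys ! (p \<circ> \<tau>) i)) ` ?I"
    if "\<tau> permutes ?I" for \<tau>
    using permutes_in_image[OF that] by (intro image_cong) (auto simp: nth)
  have perms: "{\<tau>. \<tau> permutes ?I} = (\<lambda>\<tau>. p \<circ> \<tau>) ` {\<tau>. \<tau> permutes ?I}"
  proof -
    have "\<tau> = p \<circ> (inv_into UNIV p \<circ> \<tau>)" for \<tau> :: "nat \<Rightarrow> nat"
      by (simp add: o_assoc permutes_inv_o[OF p(1)])
    moreover have "inv_into UNIV p \<circ> \<tau> permutes ?I" if "\<tau> permutes ?I" for \<tau>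
      using that p(1) by (simp add: permutes_compose permutes_inv)
    ultimately have "\<tau> \<in> (\<lambda>\<tau>. p \<circ> \<tau>) ` {\<tau>. \<tau> permutes ?I}" if "\<tau> permutes ?I" for \<tau>
      using that by blast
    moreover have "p \<circ> \<tau> permutes ?I" if "\<tau> permutes ?I" for \<tau>
      using permutes_compose[OF that p(1)] .
    ultimately show ?thesis by blast
  qed
  have "(\<lambda>\<tau>. Max ((\<lambda>i. cmod (xs ! i - ys' ! \<tau> i)) ` ?I)) ` {\<tau>. \<tau> permutes ?I}
      = (\<lambda>\<tau>. Max ((\<lambda>i. cmod (xs ! i - ys ! (p \<circ> \<tau>) i)) ` ?I)) ` {\<tau>. \<tau> permutes ?I}"
    by (intro image_cong refl) (simp only: mem_Collect_eq eq)
  also have "\<dots> = (\<lambda>\<tau>. Max ((\<lambda>i. cmod (xs ! i - ys ! \<tau> i)) ` ?I)) ` {\<tau>. \<tau> permutes ?I}"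
    by (subst (2) perms) (simp only: image_image)
  finally show ?thesis unfolding matching_dist_list_def by simp
qed

lemma opt_matching_dist_eq:
  assumes "mset xs = S" "mset ys = T" "size S = size T"
  shows "opt_matching_dist S T = matching_dist_list xs ys"
proof -
  define xs' ys' where "xs' = (SOME xs. mset xs = S)" and "ys' = (SOME ys. mset ys = T)"
  have *: "mset xs' = S" "mset ys' = T"
    unfolding xs'_def ys'_def by (rule someI_ex, rule ex_mset)+
  have len: "length xs = size S" "length ys = size S" "length xs' = size S" "length ys' = size S"
    using assms * by (metis size_mset)+
  have "matching_dist_list xs' ys' = matching_dist_list xs ys'"
    by (rule matching_dist_list_cong_left) (use assms * len in simp_all)
  also have "\<dots> = matching_dist_list xs ys"
    by (rule matching_dist_list_cong_right) (use assms * len in simp_all)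
  finally show ?thesis by (simp add: opt_matching_dist_def xs'_def ys'_def)
qed

text \<open>Square roots of the eigenvalues of the positive semidefinite matrix
  \<open>mat_adjoint M * M\<close>, in decreasing order and with multiplicity. These eigenvalues are
  real, so taking \<open>Re\<close> only changes the type.\<close>

definition singvals :: "complex mat \<Rightarrow> real list" where
  "singvals M = rev (sorted_list_of_multiset
     (image_mset (\<lambda>z. sqrt (Re z)) (eigvals (mat_adjoint M * M))))"

text \<open>\<open>singval M k\<close> is $s_k(M)$, numbered from 1 to the dimension.\<close>

definition singval :: "complex mat \<Rightarrow> nat \<Rightarrow> real" where
  "singval M k = singvals M ! (k - 1)"

definition spectral_norm :: "complex mat \<Rightarrow> real" where
  "spectral_norm M = singval M 1"

text \<open>The Ky Fan $(2,r)$-norm.\<close>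

definition ky_fan2_norm :: "nat \<Rightarrow> complex mat \<Rightarrow> real" where
  "ky_fan2_norm r M = sqrt (\<Sum>k=1..r. (singval M k)\<^sup>2)"

lemma length_singvals:
  assumes "M \<in> carrier_mat n n"
  shows "length (singvals M) = n"
proof -
  have "mat_adjoint M \<in> carrier_mat n n"
    unfolding mat_adjoint_def using assms mat_of_rows_carrier(1) by fastforce
  hence "mat_adjoint M * M \<in> carrier_mat n n"
    by (rule mult_carrier_mat) (rule assms)
  hence "size (eigvals (mat_adjoint M * M)) = n"
    by (rule size_eigvals)
  moreover have "length (singvals M) = size (mset (singvals M))"
    by (rule size_mset[symmetric])
  moreover have "mset (singvals M) = image_mset (\<lambda>z. sqrt (Re z)) (eigvals (mat_adjoint M * M))"
    unfolding singvals_def mset_rev mset_sorted_list_of_multiset ..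
  ultimately show ?thesis
    by (simp only: size_image_mset)
qed

end

(*
  If the matching distance is d, no bijection between the spectra keeps all distances below d, so
  Hall's theorem yields index sets I and J with |I| + |J| = n + 1 and |alpha_i - beta_j| >= d on
  I x J. Let U and V be unitary matrices diagonalizing A and B, and put W = U^* V. The entries of
  N = U^* (A - B) V are (alpha_i - beta_j) W_ij. As |W_ij|^2 is doubly stochastic, its sum over
  I x J is at least |I| + |J| - n = 1, so the sum of |N_ij|^2 over I x J is at least d^2. One of
  I and J has at most m_n elements, and r rows (or columns) of N carry at most the sum of the r
  largest squared singular values of A - B.
*)

theory Submission
  imports Defs
begin

text \<open>The delicate point is the final bound on r rows or columns. With M = A - B, singular
  values enter only through the eigenvalues of M^* M, so rows and columns of N are not on the same
  footing. Columns are governed by N^* N, which is unitarily similar to M^* M. Rows are governed by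
  N N^*, and treating them alike would require M M^* and M^* M to share their spectrum with
  multiplicities. This is avoided: in both cases the mass is written as a sum of the eigenvalues l_k
  of M^* M with weights in [0, 1] of total at most r, which cannot exceed the sum of the r largest.
  For columns the weights are sums of squared entries of a unitary matrix. For rows they come from
  U^* M X, where X diagonalizes M^* M: its columns are orthogonal but possibly zero, and Bessel's
  inequality controls the total weight. The number m_n is the largest possible size of the smaller
  of two sets whose sizes add up to n + 1.\<close>

section \<open>Hall's theorem and weighted sums\<close>

text \<open>Rado's argument: if deleting \<open>x\<close> from \<open>A i\<close> and deleting \<open>y\<close> from \<open>A i\<close> both destroyed the
  Hall condition, the two violating index sets would contradict it for their union and intersection.\<close>

lemma hall_marriage:
  fixes A :: "'i \<Rightarrow> 'a set"
  assumes "finite I" and "\<And>i. i \<in> I \<Longrightarrow> finite (A i)"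
    and "\<And>S. S \<subseteq> I \<Longrightarrow> card S \<le> card (\<Union> (A ` S))"
  shows "\<exists>f. (\<forall>i\<in>I. f i \<in> A i) \<and> inj_on f I"
  using assms
proof (induction "\<Sum>i\<in>I. card (A i)" arbitrary: A rule: less_induct)
  case less
  note fin = less.prems(1,2) and hall = less.prems(3)
  show ?case
  proof (cases "\<exists>i\<in>I. \<exists>x\<in>A i. \<exists>y\<in>A i. x \<noteq> y")
    case False
    have "A i \<noteq> {}" if "i \<in> I" for i
      using hall[of "{i}"] that by auto
    then have "\<forall>i\<in>I. \<exists>x. A i = {x}"
      using False by (metis is_singletonI' is_singleton_the_elem)
    then obtain f where f: "A i = {f i}" if "i \<in> I" for i by metis
    \<comment> \<open>All sets are singletons here, so the choice is forced; equal values at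
      \<open>i\<close> and \<open>j\<close> would give \<open>{i, j}\<close> a one-element union,
      against the Hall condition.\<close>
    have "f i \<noteq> f j" if "i \<in> I" "j \<in> I" "i \<noteq> j" for i j
      using hall[of "{i, j}"] f that by (auto simp: card_insert_if split: if_splits)
    then show ?thesis using f by (intro exI[of _ f]) (auto simp: inj_on_def)
  next
    case True
    then obtain i x y where ixy: "i \<in> I" "x \<in> A i" "y \<in> A i" "x \<noteq> y" by blast
    define B where "B z = A(i := A i - {z})" for z
    have finB: "finite (B z j)" if "j \<in> I" for z j
      using fin(2)[of j] that by (auto simp: B_def)
    have smaller: "(\<Sum>j\<in>I. card (B z j)) < (\<Sum>j\<in>I. card (A j))" if "z \<in> A i" for z
    proof (rule sum_strict_mono_ex1)
      show "\<forall>j\<in>I. card (B z j) \<le> card (A j)"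
        using fin(2) by (auto simp: B_def intro: card_mono)
      show "\<exists>j\<in>I. card (B z j) < card (A j)"
        using ixy(1) card_Diff1_less[OF fin(2)[OF ixy(1)] that] by (intro bexI[of _ i]) (simp_all add: B_def)
    qed (rule fin(1))
    have "\<exists>z\<in>{x, y}. \<forall>S\<subseteq>I. card S \<le> card (\<Union> (B z ` S))"
    proof (rule ccontr)
      assume neg: "\<not> ?thesis"
      \<comment> \<open>A violating set must contain \<open>i\<close>, the only index whose set has
        changed. Removing \<open>i\<close> from it costs one element and turns the strict inequality
        into a weak one.\<close>
      have ex: "\<exists>K. K \<subseteq> I - {i} \<and> card (\<Union> (A ` K) \<union> (A i - {z})) \<le> card K" if z: "z \<in> {x, y}" for z
      proof -
        from neg z obtain S where S: "S \<subseteq> I" "card (\<Union> (B z ` S)) < card S"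
          by (auto simp: not_le)
        have iS: "i \<in> S"
        proof (rule ccontr)
          assume "i \<notin> S"
          then have "B z ` S = A ` S" by (auto simp: B_def)
          with S hall[of S] show False by simp
        qed
        have "\<Union> (B z ` S) = \<Union> (A ` (S - {i})) \<union> (A i - {z})"
          using iS by (auto simp: B_def split: if_splits)
        moreover have "card S = Suc (card (S - {i}))"
          using iS S fin(1) by (metis card_Suc_Diff1 finite_subset)
        ultimately show ?thesis using S by (intro exI[of _ "S - {i}"]) auto
      qed
      from ex[of x] ex[of y] obtain K L where K: "K \<subseteq> I - {i}" "card (\<Union> (A ` K) \<union> (A i - {x})) \<le> card K"
        and L: "L \<subseteq> I - {i}" "card (\<Union> (A ` L) \<union> (A i - {y})) \<le> card L"
        by auto
      define P Q where "P = \<Union> (A ` K) \<union> (A i - {x})" and "Q = \<Union> (A ` L) \<union> (A i - {y})"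
      have finKL: "finite K" "finite L" using K L fin(1) by (auto intro: finite_subset)
      have finPQ: "finite P" "finite Q"
        using K L finKL fin(2) ixy(1) unfolding P_def Q_def by blast+
      \<comment> \<open>Since \<open>x\<close> and \<open>y\<close> differ, each survives the
        deletion of the other, so all of \<open>A i\<close> reappears in the union.\<close>
      have PQ: "P \<union> Q = \<Union> (A ` insert i (K \<union> L))"
        using ixy by (auto simp: P_def Q_def)
      have un: "Suc (card (K \<union> L)) \<le> card (P \<union> Q)"
      proof -
        have "insert i (K \<union> L) \<subseteq> I" "i \<notin> K \<union> L" using K(1) L(1) ixy(1) by blast+
        then show ?thesis
          using hall[of "insert i (K \<union> L)"] finKL unfolding PQ by simp
      qed
      have "\<Union> (A ` (K \<inter> L)) \<subseteq> P \<inter> Q" by (auto simp: P_def Q_def)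
      then have inter: "card (K \<inter> L) \<le> card (P \<inter> Q)"
        using le_trans[OF hall card_mono, of "K \<inter> L" "P \<inter> Q"] K(1) finPQ by blast
      \<comment> \<open>Inclusion-exclusion on both sides: |P| + |Q| is at least |K \<union> L| + 1
        + |K \<inter> L| = |K| + |L| + 1.\<close>
      have "card P \<le> card K" "card Q \<le> card L" using K(2) L(2) by (simp_all add: P_def Q_def)
      with un inter card_Un_Int[OF finPQ] card_Un_Int[OF finKL] show False by linarith
    qed
    then obtain z where z: "z \<in> {x, y}" "\<And>S. S \<subseteq> I \<Longrightarrow> card S \<le> card (\<Union> (B z ` S))" by blast
    from z ixy have "z \<in> A i" by auto
    from less.hyps[OF smaller[OF this] fin(1) finB z(2)]
    obtain f where f: "\<forall>j\<in>I. f j \<in> B z j" "inj_on f I" by blast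
    then have "\<forall>j\<in>I. f j \<in> A j" by (auto simp: B_def split: if_splits)
    with f show ?thesis by blast
  qed
qed

text \<open>Threshold argument: subtract the m-th value \<open>t\<close> from \<open>f\<close>. The
  shifted values are nonnegative up to that place, where weight 1 is the most they can get, and
  nonpositive after it, where weight 0 is best. What was subtracted amounts to \<open>t\<close>
  times the total weight, hence at most \<open>t * m\<close>.\<close>

lemma antimono_weighted_sum_le:
  fixes f c :: "nat \<Rightarrow> real"
  assumes "m \<le> n" and anti: "\<And>i j. i \<le> j \<Longrightarrow> j < n \<Longrightarrow> f j \<le> f i"
    and nonneg: "\<And>i. i < n \<Longrightarrow> 0 \<le> f i"
    and c: "\<And>i. i < n \<Longrightarrow> 0 \<le> c i" "\<And>i. i < n \<Longrightarrow> c i \<le> 1"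
    and total: "(\<Sum>i<n. c i) \<le> real m"
  shows "(\<Sum>i<n. f i * c i) \<le> (\<Sum>i<m. f i)"
proof (cases "m = 0")
  case True
  with c total have "c i = 0" if "i < n" for i
    using that sum_nonneg_leq_bound[of "{..<n}" c 0 i]
    by (metis antisym finite_lessThan lessThan_iff of_nat_0 sum_nonneg)
  with True show ?thesis by simp
next
  case False
  \<comment> \<open>For \<open>m = 0\<close> truncated subtraction would make this
    \<open>f 0\<close>, hence the separate case above.\<close>
  define t where "t = f (m - 1)"
  have t: "0 \<le> t" using False assms(1) nonneg by (simp add: t_def)
  have "f i * c i \<le> (if i < m then f i - t else 0) + t * c i" if i: "i < n" for i
  proof (cases "i < m")
    case True
    then have "t \<le> f i" unfolding t_def using anti False assms(1) by simp
    then have "(f i - t) * c i \<le> (f i - t) * 1"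
      using c(2)[OF i] by (intro mult_left_mono) auto
    with True show ?thesis by (simp add: algebra_simps)
  next
    case False
    then have "f i \<le> t" unfolding t_def using anti i by simp
    with False c(1)[OF i] show ?thesis by (simp add: mult_right_mono)
  qed
  then have "(\<Sum>i<n. f i * c i) \<le> (\<Sum>i<n. (if i < m then f i - t else 0) + t * c i)"
    by (intro sum_mono) simp
  also have "\<dots> = (\<Sum>i<m. f i - t) + t * (\<Sum>i<n. c i)"
  proof -
    have "(\<Sum>i<n. if i < m then f i - t else 0) = (\<Sum>i<m. f i - t)"
      using assms(1) by (intro sum.mono_neutral_cong_right) auto
    then show ?thesis by (simp add: sum.distrib sum_distrib_left)
  qed
  also have "\<dots> \<le> (\<Sum>i<m. f i - t) + t * real m"
    using total t by (intro add_left_mono mult_left_mono)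
  also have "\<dots> = (\<Sum>i<m. f i)" by (simp add: sum_subtractf)
  finally show ?thesis .
qed

section \<open>Unitary diagonalization of normal matrices\<close>

lemma mat_adjoint_carrier [simp]: "A \<in> carrier_mat n m \<Longrightarrow> mat_adjoint A \<in> carrier_mat m n"
  for A :: "complex mat"
  unfolding mat_adjoint_def by (auto simp: mat_of_rows_def)

lemma dim_mat_adjoint [simp]:
  "dim_row (mat_adjoint A) = dim_col A" "dim_col (mat_adjoint A) = dim_row A"
  for A :: "complex mat"
  unfolding mat_adjoint_def by auto

lemma index_mat_adjoint [simp]:
  "i < dim_col A \<Longrightarrow> j < dim_row A \<Longrightarrow> mat_adjoint A $$ (i, j) = cnj (A $$ (j, i))"
  for A :: "complex mat"
  unfolding mat_adjoint_def by (simp add: mat_of_rows_index)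

lemma mat_adjoint_adjoint [simp]: "mat_adjoint (mat_adjoint A) = A"
  for A :: "complex mat"
  by (rule eq_matI) auto

lemma mult_carrier_square [simp]:
  "A \<in> carrier_mat n n \<Longrightarrow> B \<in> carrier_mat n n \<Longrightarrow> A * B \<in> carrier_mat n n"
  by simp

lemma mat_adjoint_mult:
  fixes A B :: "complex mat"
  assumes "A \<in> carrier_mat n m" "B \<in> carrier_mat m k"
  shows "mat_adjoint (A * B) = mat_adjoint B * mat_adjoint A"
  by (rule eq_matI) (use assms in \<open>auto simp: scalar_prod_def mult.commute\<close>)

lemma mat_adjoint_four_block:
  fixes A B C D :: "complex mat"
  assumes "A \<in> carrier_mat n1 m1" "B \<in> carrier_mat n1 m2"
    "C \<in> carrier_mat n2 m1" "D \<in> carrier_mat n2 m2"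
  shows "mat_adjoint (four_block_mat A B C D)
    = four_block_mat (mat_adjoint A) (mat_adjoint C) (mat_adjoint B) (mat_adjoint D)"
  by (rule eq_matI) (use assms in auto)

lemma mult_cnj_cmod: "z * cnj z = (complex_of_real (cmod z))\<^sup>2"
  by (simp only: complex_norm_square flip: of_real_power)

lemma index_mult_adjoint:
  fixes A :: "complex mat"
  assumes "A \<in> carrier_mat n m" "i < n"
  shows "(A * mat_adjoint A) $$ (i, i) = of_real (\<Sum>k<m. (cmod (A $$ (i, k)))\<^sup>2)"
  using assms by (auto simp: scalar_prod_def mult_cnj_cmod lessThan_atLeast0 intro!: sum.cong)

lemma index_adjoint_mult:
  fixes A :: "complex mat"
  assumes "A \<in> carrier_mat n m" "j < m"
  shows "(mat_adjoint A * A) $$ (j, j) = of_real (\<Sum>k<n. (cmod (A $$ (k, j)))\<^sup>2)"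
  using assms
  by (auto simp: scalar_prod_def mult_cnj_cmod lessThan_atLeast0 mult.commute intro!: sum.cong)

definition unitary_mat :: "nat \<Rightarrow> complex mat \<Rightarrow> bool" where
  "unitary_mat n U \<longleftrightarrow> U \<in> carrier_mat n n \<and> mat_adjoint U * U = 1\<^sub>m n"

lemma unitary_matD:
  assumes "unitary_mat n U"
  shows "U \<in> carrier_mat n n" "mat_adjoint U * U = 1\<^sub>m n" "U * mat_adjoint U = 1\<^sub>m n"
  using assms mat_mult_left_right_inverse[of "mat_adjoint U" n U] by (auto simp: unitary_mat_def)

lemma unitary_mat_adjoint: "unitary_mat n U \<Longrightarrow> unitary_mat n (mat_adjoint U)"
  by (frule unitary_matD(1), drule unitary_matD(3)) (simp add: unitary_mat_def)

lemma unitary_mat_cancel: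
  assumes "unitary_mat n U" "N \<in> carrier_mat n k"
  shows "U * (mat_adjoint U * N) = N" "mat_adjoint U * (U * N) = N"
proof -
  note U = unitary_matD[OF assms(1)]
  have "U * (mat_adjoint U * N) = U * mat_adjoint U * N"
    by (rule assoc_mult_mat[symmetric]) (use U(1) assms(2) in auto)
  then show "U * (mat_adjoint U * N) = N"
    unfolding U(3) left_mult_one_mat[OF assms(2)] .
  have "mat_adjoint U * (U * N) = mat_adjoint U * U * N"
    by (rule assoc_mult_mat[symmetric]) (use U(1) assms(2) in auto)
  then show "mat_adjoint U * (U * N) = N"
    unfolding U(2) left_mult_one_mat[OF assms(2)] .
qed

text \<open>The inner product of \<open>U\<close> with its adjoint cancels. The outer factors are
  kept general so that the lemma covers conjugation of normal matrices as well as Gram matrices,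
  where the two sides carry a different matrix than \<open>U\<close>.\<close>

lemma adjoint_conj_mult:
  fixes U V W M N :: "complex mat"
  assumes "unitary_mat n U" "M \<in> carrier_mat n n" "N \<in> carrier_mat n n" "V \<in> carrier_mat n n"
    "W \<in> carrier_mat n n"
  shows "(W * M * U) * (mat_adjoint U * N * V) = W * (M * N) * V"
  by (simp only: assoc_mult_mat[of _ n n _ n _ n] mult_carrier_square mat_adjoint_carrier
      unitary_mat_cancel[where k = n, OF assms(1)] assms(2-) unitary_matD(1)[OF assms(1)])

lemma unitary_mat_mult:
  assumes "unitary_mat n U" "unitary_mat n V"
  shows "unitary_mat n (U * V)"
proof -
  note UV = unitary_matD[OF assms(1)] unitary_matD[OF assms(2)]
  have "mat_adjoint (U * V) * (U * V) = mat_adjoint V * (mat_adjoint U * (U * V))"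
    by (simp only: mat_adjoint_mult[of _ n n _ n] assoc_mult_mat[of _ n n _ n _ n]
        mult_carrier_square mat_adjoint_carrier UV(1,4))
  then show ?thesis
    unfolding unitary_mat_cancel[OF assms(1) UV(4)] UV(5) unitary_mat_def using UV(1,4) by simp
qed

lemma mat_adjoint_conj:
  fixes A U V :: "complex mat"
  assumes "A \<in> carrier_mat n n" "U \<in> carrier_mat n n" "V \<in> carrier_mat n n"
  shows "mat_adjoint (mat_adjoint U * A * V) = mat_adjoint V * mat_adjoint A * U"
  by (simp only: mat_adjoint_mult[of _ n n _ n] assoc_mult_mat[of _ n n _ n _ n] mat_adjoint_adjoint
      mult_carrier_square mat_adjoint_carrier assms)

lemma adjoint_mult_conj:
  fixes M U V :: "complex mat"
  assumes "unitary_mat n U" "M \<in> carrier_mat n n" "V \<in> carrier_mat n n"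
  shows "mat_adjoint (mat_adjoint U * M * V) * (mat_adjoint U * M * V)
    = mat_adjoint V * (mat_adjoint M * M) * V"
  unfolding mat_adjoint_conj[OF assms(2) unitary_matD(1)[OF assms(1)] assms(3)]
  by (simp only: adjoint_conj_mult[OF assms(1)] mat_adjoint_carrier assms(2,3))

lemma normal_mat_conj:
  assumes "unitary_mat n U" "A \<in> carrier_mat n n" "normal_mat A"
  shows "normal_mat (mat_adjoint U * A * U)"
  using assms(3) unfolding normal_mat_def
    mat_adjoint_conj[OF assms(2) unitary_matD(1)[OF assms(1)] unitary_matD(1)[OF assms(1)]]
  by (simp only: adjoint_conj_mult[OF assms(1)] assms(2) mat_adjoint_carrier unitary_matD(1)[OF assms(1)])

text \<open>Gram-Schmidt applied to a basis starting with \<open>v\<close> leaves \<open>v\<close>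
  in first place; dividing each vector by its length gives the columns. The scalar \<open>c\<close>
  records that \<open>v\<close> is not normalized, which is harmless for an eigenvector.\<close>

lemma unitary_mat_with_first_column:
  assumes v: "v \<in> carrier_vec n" "v \<noteq> 0\<^sub>v n"
  shows "\<exists>U c. unitary_mat n U \<and> col U 0 = c \<cdot>\<^sub>v v"
proof -
  have n: "0 < n" using v by (cases n) auto
  interpret cof_vec_space n "TYPE(complex)" .
  define ws where "ws = gram_schmidt n (basis_completion v)"
  note b = basis_completion[OF v]
  from gram_schmidt_result[OF b(2,4,5) refl] b(6)
  have ws: "set ws \<subseteq> carrier_vec n" "corthogonal ws" "length ws = n"
    by (auto simp: ws_def)
  obtain vs where "basis_completion v = v # vs"
    using b(6,7) n by (cases "basis_completion v") auto
  then have "hd ws = v" using gram_schmidt_hd[OF v(1)] by (simp add: ws_def)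
  then have ws0: "ws ! 0 = v" using ws(3) n by (metis hd_conv_nth length_greater_0_conv)
  define l where "l j = sqrt (\<Sum>k<n. (cmod (ws ! j $ k))\<^sup>2)" for j
  have prod: "ws ! j \<bullet>c ws ! i = (\<Sum>k<n. cnj (ws ! i $ k) * ws ! j $ k)" if "i < n" "j < n" for i j
  proof -
    have "dim_vec (ws ! i) = n" using ws that by (metis carrier_vecD nth_mem subsetD)
    then show ?thesis by (simp add: scalar_prod_def lessThan_atLeast0 mult.commute)
  qed
  have sq: "ws ! j \<bullet>c ws ! j = of_real ((l j)\<^sup>2)" if "j < n" for j
    using that by (simp add: prod l_def sum_nonneg mult_cnj_cmod mult.commute)
  \<comment> \<open>\<open>corthogonal\<close> is an equivalence: distinct vectors have product
    zero, and a vector with itself has not. This is what permits the division by lengths.\<close>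
  have l: "l j \<noteq> 0" if "j < n" for j
    using corthogonalD[OF ws(2), of j j] sq[OF that] that ws(3) by auto
  define U where "U = mat n n (\<lambda>(i, j). ws ! j $ i / of_real (l j))"
  have "(mat_adjoint U * U) $$ (i, j) = 1\<^sub>m n $$ (i, j)" if ij: "i < n" "j < n" for i j
  proof -
    have "(mat_adjoint U * U) $$ (i, j) = ws ! j \<bullet>c ws ! i / (of_real (l i) * of_real (l j))"
      using ij by (simp add: prod) (simp add: U_def scalar_prod_def lessThan_atLeast0 sum_divide_distrib)
    also have "\<dots> = 1\<^sub>m n $$ (i, j)"
    proof (cases "i = j")
      case True
      with l ij show ?thesis by (simp add: sq power2_eq_square del: of_real_mult flip: of_real_mult)
    next
      case False
      with corthogonalD[OF ws(2), of j i] ij ws(3) show ?thesis by simp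
    qed
    finally show ?thesis .
  qed
  then have "unitary_mat n U"
    unfolding unitary_mat_def by (intro conjI eq_matI) (auto simp: U_def)
  moreover have "col U 0 = (1 / of_real (l 0)) \<cdot>\<^sub>v v"
    using n v ws0 by (intro eq_vecI) (auto simp: U_def)
  ultimately show ?thesis by blast
qed

abbreviation diag_fun_mat :: "nat \<Rightarrow> (nat \<Rightarrow> complex) \<Rightarrow> complex mat" where
  "diag_fun_mat n d \<equiv> mat n n (\<lambda>(i, j). if i = j then d i else 0)"

text \<open>Deflation: in an orthonormal basis that starts with an eigenvector the first column
  vanishes below the diagonal. Normality forces the first row to vanish as well, so the matrix
  splits and the remaining corner is again normal.\<close>

theorem normal_mat_unitary_diagonalization:
  assumes "A \<in> carrier_mat n n" "normal_mat A"
  shows "\<exists>U d. unitary_mat n U \<and> mat_adjoint U * A * U = diag_fun_mat n d"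
  using assms
proof (induction n arbitrary: A)
  case 0
  then show ?case
    by (intro exI[of _ "1\<^sub>m 0"] exI) (auto simp: unitary_mat_def)
next
  case (Suc n A)
  note A = Suc.prems(1)
  from char_poly_factorized[OF A] obtain es where
    "char_poly A = (\<Prod>a\<leftarrow>es. [:- a, 1:])" "length es = Suc n" by auto
  then obtain e where "poly (char_poly A) e = 0"
    by (cases es) auto
  then have "eigenvalue A e" using eigenvalue_root_char_poly[OF A] by simp
  then obtain v where v: "v \<in> carrier_vec (Suc n)" "v \<noteq> 0\<^sub>v (Suc n)" "A *\<^sub>v v = e \<cdot>\<^sub>v v"
    using A by (auto simp: eigenvalue_def eigenvector_def)
  from unitary_mat_with_first_column[OF v(1,2)] obtain U c where
    U: "unitary_mat (Suc n) U" "col U 0 = c \<cdot>\<^sub>v v" by blast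
  note U' = unitary_matD[OF U(1)]
  have colU: "col U 0 \<in> carrier_vec (Suc n)" using col_dim[of U 0] U'(1) by auto
  define A' where "A' = mat_adjoint U * A * U"
  have A': "A' \<in> carrier_mat (Suc n) (Suc n)" using A U' by (simp add: A'_def)
  have normal: "normal_mat A'"
    unfolding A'_def by (rule normal_mat_conj[OF U(1) A Suc.prems(2)])
  have "col A' 0 = mat_adjoint U * A *\<^sub>v col U 0"
    unfolding A'_def by (rule col_mult2[of _ "Suc n" "Suc n" _ "Suc n"]) (use A U' in auto)
  also have "\<dots> = mat_adjoint U *\<^sub>v (A *\<^sub>v col U 0)"
    by (rule assoc_mult_mat_vec[of _ "Suc n" "Suc n" _ "Suc n"]) (use A U' colU in auto)
  also have "A *\<^sub>v col U 0 = e \<cdot>\<^sub>v col U 0"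
    unfolding U(2) mult_mat_vec[OF A v(1)] v(3) smult_smult_assoc by (simp only: mult.commute)
  also have "mat_adjoint U *\<^sub>v (e \<cdot>\<^sub>v col U 0) = e \<cdot>\<^sub>v (mat_adjoint U *\<^sub>v col U 0)"
    by (rule mult_mat_vec[of _ "Suc n" "Suc n"]) (use U' colU in auto)
  also have "mat_adjoint U *\<^sub>v col U 0 = col (mat_adjoint U * U) 0"
    by (rule col_mult2[of _ "Suc n" "Suc n" _ "Suc n", symmetric]) (use U' in auto)
  finally have col0: "col A' 0 = e \<cdot>\<^sub>v col (1\<^sub>m (Suc n)) 0" by (simp add: U')
  have col0_index: "A' $$ (i, 0) = (if i = 0 then e else 0)" if "i < Suc n" for i
    using arg_cong[OF col0, of "\<lambda>w. w $ i"] that A' by (auto simp: unit_vec_def)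
  \<comment> \<open>Comparing the top left entries of the two products in the normality equation:
    first row and first column have the same norm. The column consists of \<open>e\<close> alone, so
    nothing is left for the rest of the row.\<close>
  have "(\<Sum>k<Suc n. (cmod (A' $$ (0, k)))\<^sup>2) = (\<Sum>k<Suc n. (cmod (A' $$ (k, 0)))\<^sup>2)"
    using arg_cong[OF normal[unfolded normal_mat_def], of "\<lambda>M. M $$ (0, 0)"]
    unfolding index_mult_adjoint[OF A' zero_less_Suc] index_adjoint_mult[OF A' zero_less_Suc]
      of_real_eq_iff .
  then have "(\<Sum>k<n. (cmod (A' $$ (0, Suc k)))\<^sup>2) = 0"
    unfolding sum.lessThan_Suc_shift by (simp add: col0_index)
  then have row0_index: "A' $$ (0, Suc k) = 0" if "k < n" for k
    using that by (simp add: sum_nonneg_eq_0_iff)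
  define C where "C = mat n n (\<lambda>(i, j). A' $$ (Suc i, Suc j))"
  let ?E = "mat 1 1 (\<lambda>_. e)"
  have block: "A' = four_block_mat ?E (0\<^sub>m 1 n) (0\<^sub>m n 1) C"
  proof (rule eq_matI)
    fix i j assume "i < dim_row (four_block_mat ?E (0\<^sub>m 1 n) (0\<^sub>m n 1) C)"
      "j < dim_col (four_block_mat ?E (0\<^sub>m 1 n) (0\<^sub>m n 1) C)"
    then show "A' $$ (i, j) = four_block_mat ?E (0\<^sub>m 1 n) (0\<^sub>m n 1) C $$ (i, j)"
      using col0_index row0_index by (cases i; cases j) (auto simp: C_def)
  qed (use A' in \<open>auto simp: C_def\<close>)
  have C: "C \<in> carrier_mat n n" by (simp add: C_def)
  have adj: "mat_adjoint A' = four_block_mat (mat_adjoint ?E) (0\<^sub>m 1 n) (0\<^sub>m n 1) (mat_adjoint C)"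
  proof -
    have z: "mat_adjoint (0\<^sub>m 1 n :: complex mat) = 0\<^sub>m n 1" "mat_adjoint (0\<^sub>m n 1 :: complex mat) = 0\<^sub>m 1 n"
      by (rule eq_matI; simp)+
    show ?thesis unfolding block by (subst mat_adjoint_four_block) (use C z in auto)
  qed
  have "normal_mat C"
  proof -
    have 1: "A' * mat_adjoint A' = four_block_mat (?E * mat_adjoint ?E) (0\<^sub>m 1 n) (0\<^sub>m n 1) (C * mat_adjoint C)"
      unfolding adj by (subst block, subst mult_four_block_mat[of _ 1 1 _ n _ n _ _ 1 _ n]) (use C in auto)
    have 2: "mat_adjoint A' * A' = four_block_mat (mat_adjoint ?E * ?E) (0\<^sub>m 1 n) (0\<^sub>m n 1) (mat_adjoint C * C)"
      unfolding adj by (subst block, subst mult_four_block_mat[of _ 1 1 _ n _ n _ _ 1 _ n]) (use C in auto)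
    have "(C * mat_adjoint C) $$ (i, j) = (mat_adjoint C * C) $$ (i, j)" if "i < n" "j < n" for i j
      using arg_cong[OF normal[unfolded normal_mat_def 1 2], of "\<lambda>M. M $$ (Suc i, Suc j)"] that C
      by (simp del: index_mult_mat(1))
    then show ?thesis unfolding normal_mat_def using C by (intro eq_matI) auto
  qed
  from Suc.IH[OF C this] obtain P d where P: "unitary_mat n P"
    and d: "mat_adjoint P * C * P = diag_fun_mat n d" by blast
  note P' = unitary_matD[OF P]
  \<comment> \<open>Bordering \<open>P\<close> with a 1 fixes the eigenvector already found and acts
    only on the corner.\<close>
  define Q where "Q = four_block_mat (1\<^sub>m 1) (0\<^sub>m 1 n) (0\<^sub>m n 1) P"
  have Q_adj: "mat_adjoint Q = four_block_mat (1\<^sub>m 1) (0\<^sub>m 1 n) (0\<^sub>m n 1) (mat_adjoint P)"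
  proof -
    have z: "mat_adjoint (0\<^sub>m 1 n :: complex mat) = 0\<^sub>m n 1" "mat_adjoint (0\<^sub>m n 1 :: complex mat) = 0\<^sub>m 1 n"
      "mat_adjoint (1\<^sub>m 1 :: complex mat) = 1\<^sub>m 1"
      by (rule eq_matI; simp)+
    show ?thesis unfolding Q_def by (subst mat_adjoint_four_block) (use P' z in auto)
  qed
  have Q: "unitary_mat (Suc n) Q"
  proof -
    have "mat_adjoint Q * Q = four_block_mat (1\<^sub>m 1) (0\<^sub>m 1 n) (0\<^sub>m n 1) (1\<^sub>m n)"
      unfolding Q_adj unfolding Q_def
      by (subst mult_four_block_mat[of _ 1 1 _ n _ n _ _ 1 _ n]) (use P' in auto)
    also have "\<dots> = 1\<^sub>m (Suc n)" by (rule eq_matI) auto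
    finally have "mat_adjoint Q * Q = 1\<^sub>m (Suc n)" .
    moreover have "Q \<in> carrier_mat (Suc n) (Suc n)"
      unfolding Q_def using four_block_carrier_mat[of "1\<^sub>m 1" 1 1 P n n] P' by simp
    ultimately show ?thesis by (simp add: unitary_mat_def)
  qed
  have "mat_adjoint Q * A' * Q = four_block_mat ?E (0\<^sub>m 1 n) (0\<^sub>m n 1) (mat_adjoint P * C * P)"
  proof -
    have "mat_adjoint Q * A' = four_block_mat ?E (0\<^sub>m 1 n) (0\<^sub>m n 1) (mat_adjoint P * C)"
      unfolding Q_adj by (subst block, subst mult_four_block_mat[of _ 1 1 _ n _ n _ _ 1 _ n]) (use P' C in auto)
    then show ?thesis
      unfolding Q_def by (simp only:) (subst mult_four_block_mat[of _ 1 1 _ n _ n _ _ 1 _ n], use P' C in auto)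
  qed
  also have "\<dots> = diag_fun_mat (Suc n) (\<lambda>i. case i of 0 \<Rightarrow> e | Suc k \<Rightarrow> d k)"
    unfolding d by (rule eq_matI) (auto split: nat.split)
  also have "mat_adjoint Q * A' * Q = mat_adjoint (U * Q) * A * (U * Q)"
  proof -
    note carr = A U'(1) unitary_matD(1)[OF Q] mat_adjoint_carrier[OF U'(1)]
      mat_adjoint_carrier[OF unitary_matD(1)[OF Q]] mult_carrier_square
    show ?thesis
      unfolding A'_def mat_adjoint_mult[OF U'(1) unitary_matD(1)[OF Q]]
      by (simp only: carr assoc_mult_mat[of _ "Suc n" "Suc n" _ "Suc n" _ "Suc n"])
  qed
  finally show ?case using unitary_mat_mult[OF U(1) Q] by (intro exI conjI)
qed

section \<open>Singular values\<close>

text \<open>\<open>C\<close> is general because it is a unitary change of basis in the column bound,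
  but a rescaled adjoint in the proof of Bessel's inequality.\<close>

lemma index_conj_diag:
  fixes C :: "complex mat" and l :: "nat \<Rightarrow> real"
  assumes C: "C \<in> carrier_mat n n" and i: "i < n"
  shows "(mat_adjoint C * diag_fun_mat n (\<lambda>k. of_real (l k)) * C) $$ (i, i)
    = of_real (\<Sum>k<n. l k * (cmod (C $$ (k, i)))\<^sup>2)"
proof -
  let ?D = "diag_fun_mat n (\<lambda>k. of_real (l k) :: complex)"
  define E where "E = mat_adjoint C * ?D"
  have E: "E \<in> carrier_mat n n" using C by (simp add: E_def)
  have "E $$ (i, k) = cnj (C $$ (k, i)) * of_real (l k)" if "k < n" for k
    using C i that
    by (simp add: E_def scalar_prod_def lessThan_atLeast0 if_distrib[of "\<lambda>x. _ * x"] sum.delta cong: if_cong)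
  then have "(E * C) $$ (i, i) = (\<Sum>k<n. cnj (C $$ (k, i)) * of_real (l k) * C $$ (k, i))"
    using C E i by (simp add: scalar_prod_def lessThan_atLeast0)
  also have "\<dots> = (\<Sum>k<n. of_real (l k) * (C $$ (k, i) * cnj (C $$ (k, i))))"
    by (simp add: ac_simps)
  also have "\<dots> = of_real (\<Sum>k<n. l k * (cmod (C $$ (k, i)))\<^sup>2)"
    by (simp add: mult_cnj_cmod)
  finally show ?thesis unfolding E_def .
qed

lemma unitary_mat_col_sum:
  assumes "unitary_mat n U" "j < n"
  shows "(\<Sum>k<n. (cmod (U $$ (k, j)))\<^sup>2) = 1"
  using index_adjoint_mult[OF unitary_matD(1)[OF assms(1)] assms(2)] assms(2)
  unfolding unitary_matD(2)[OF assms(1)] by (metis index_one_mat(1) of_real_eq_1_iff)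

lemma unitary_mat_row_sum:
  assumes "unitary_mat n U" "i < n"
  shows "(\<Sum>k<n. (cmod (U $$ (i, k)))\<^sup>2) = 1"
  using index_mult_adjoint[OF unitary_matD(1)[OF assms(1)] assms(2)] assms(2)
  unfolding unitary_matD(3)[OF assms(1)] by (metis index_one_mat(1) of_real_eq_1_iff)

lemma proots_prod_linear: "proots (\<Prod>a\<leftarrow>as. [:- a, 1::complex:]) = mset as"
proof (induction as)
  case (Cons a as)
  have "(\<Prod>a\<leftarrow>as. [:- a, 1::complex:]) \<noteq> 0"
    by (induction as) (auto simp del: mult_pCons_left)
  with Cons show ?case
    by (simp add: proots_mult del: mult_pCons_left)
qed simp

text \<open>Similar matrices share their characteristic polynomial, and a triangular one shows its
  roots on the diagonal. This lists the spectrum in the order of the eigenbasis, so that eigenvalue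
  indices and matrix indices agree.\<close>

lemma eigvals_unitary_diagonalization:
  assumes A: "A \<in> carrier_mat n n" and U: "unitary_mat n U"
    and d: "mat_adjoint U * A * U = diag_fun_mat n d"
  shows "eigvals A = mset (map d [0..<n])"
proof -
  note U' = unitary_matD[OF U]
  have "similar_mat_wit (diag_fun_mat n d) A (mat_adjoint U) U"
    by (rule similar_mat_witI[of _ _ n]) (use U' A d in auto)
  then have "char_poly A = char_poly (diag_fun_mat n d)"
    using char_poly_similar[of "diag_fun_mat n d" A] unfolding similar_mat_def by metis
  also have "\<dots> = (\<Prod>a\<leftarrow>diag_mat (diag_fun_mat n d). [:- a, 1:])"
    by (rule char_poly_upper_triangular[of _ n]) auto
  also have "diag_mat (diag_fun_mat n d) = map d [0..<n]"
    by (auto simp: diag_mat_def)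
  finally show ?thesis by (simp only: eigvals_def proots_prod_linear)
qed

text \<open>The diagonalization produces the eigenvalues in an arbitrary order, whereas
  \<open>singvals\<close> is sorted; \<open>p\<close> reconciles the two.\<close>

lemma singvals_diagonalization:
  assumes M: "M \<in> carrier_mat n n"
  shows "\<exists>X l p. unitary_mat n X
    \<and> mat_adjoint X * (mat_adjoint M * M) * X = diag_fun_mat n (\<lambda>k. of_real (l k))
    \<and> (\<forall>k. 0 \<le> l k) \<and> p permutes {..<n} \<and> (\<forall>k<n. singvals M ! k = sqrt (l (p k)))"
proof -
  let ?G = "mat_adjoint M * M"
  have G: "?G \<in> carrier_mat n n" using M by simp
  have "mat_adjoint ?G = ?G"
    using mat_adjoint_mult[OF mat_adjoint_carrier[OF M] M] by simp
  then have "normal_mat ?G" by (simp only: normal_mat_def)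
  from normal_mat_unitary_diagonalization[OF G this] obtain X d where X: "unitary_mat n X"
    and d: "mat_adjoint X * ?G * X = diag_fun_mat n d" by blast
  note X' = unitary_matD[OF X]
  \<comment> \<open>The Gram matrix of \<open>Z\<close> is the diagonalized one, so each eigenvalue
    is the squared norm of a column of \<open>Z\<close>. That it is real and nonnegative is then
    visible.\<close>
  define Z where "Z = mat_adjoint X * M * X"
  have Z: "Z \<in> carrier_mat n n" using X' M by (simp add: Z_def)
  define l where "l k = (\<Sum>i<n. (cmod (Z $$ (i, k)))\<^sup>2)" for k
  have l: "0 \<le> l k" for k by (simp add: l_def sum_nonneg)
  have "d k = of_real (l k)" if "k < n" for k
    using index_adjoint_mult[OF Z that] that
    unfolding Z_def adjoint_mult_conj[OF X M X'(1)] d l_def by simp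
  then have diag: "diag_fun_mat n d = diag_fun_mat n (\<lambda>k. of_real (l k))"
    by (intro eq_matI) auto
  have "mset (singvals M) = image_mset (\<lambda>z. sqrt (Re z)) (eigvals ?G)"
    by (simp add: singvals_def)
  also have "\<dots> = mset (map (\<lambda>k. sqrt (l k)) [0..<n])"
    unfolding eigvals_unitary_diagonalization[OF G X d[unfolded diag]] by (simp add: image_mset.compositionality o_def)
  finally obtain p where p: "p permutes {..<n}"
    "permute_list p (map (\<lambda>k. sqrt (l k)) [0..<n]) = singvals M"
    using mset_eq_permutation[of "singvals M" "map (\<lambda>k. sqrt (l k)) [0..<n]"] by auto
  have nth: "singvals M ! k = sqrt (l (p k))" if "k < n" for k
    using that p(1) permutes_in_image[OF p(1), of k] by (simp flip: p(2) add: permute_list_nth)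
  with X d[unfolded diag] l p(1) show ?thesis by blast
qed

lemma singval_nonneg:
  assumes "M \<in> carrier_mat n n" "k < n"
  shows "0 \<le> singval M (Suc k)"
  using singvals_diagonalization[OF assms(1)] assms(2) by (auto simp: singval_def)

lemma singval_antimono:
  assumes "M \<in> carrier_mat n n" "i \<le> j" "j < n"
  shows "singval M (Suc j) \<le> singval M (Suc i)"
proof -
  have "sorted (rev (singvals M))" by (simp add: singvals_def)
  from sorted_rev_nth_mono[OF this assms(2)] show ?thesis
    using assms(3) by (simp add: singval_def length_singvals[OF assms(1)])
qed

text \<open>A variational principle in the spirit of Ky Fan. The weights are quantified inside the
  existential because they are later built from \<open>X\<close> and \<open>l\<close>
  themselves.\<close>

lemma singval_weighted_sum:
  assumes M: "M \<in> carrier_mat n n"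
  shows "\<exists>X l. unitary_mat n X
    \<and> mat_adjoint X * (mat_adjoint M * M) * X = diag_fun_mat n (\<lambda>k. of_real (l k))
    \<and> (\<forall>c m. m \<le> n \<longrightarrow> (\<forall>k<n. 0 \<le> c k \<and> c k \<le> 1) \<longrightarrow> (\<Sum>k<n. c k) \<le> real m
        \<longrightarrow> (\<Sum>k<n. l k * c k) \<le> (\<Sum>k=1..m. (singval M k)\<^sup>2))"
proof -
  from singvals_diagonalization[OF M] obtain X l p where X: "unitary_mat n X"
    and D: "mat_adjoint X * (mat_adjoint M * M) * X = diag_fun_mat n (\<lambda>k. of_real (l k))"
    and l: "\<And>k. 0 \<le> l k" and p: "p permutes {..<n}"
    and nth: "\<And>k. k < n \<Longrightarrow> singvals M ! k = sqrt (l (p k))"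
    by blast
  have sq: "l (p k) = (singval M (Suc k))\<^sup>2" if "k < n" for k
    using l that by (simp add: singval_def nth)
  have pn: "p k < n" if "k < n" for k using permutes_in_image[OF p, of k] that by simp
  have perm: "(\<Sum>k<n. g (p k)) = (\<Sum>k<n. g k)" for g :: "nat \<Rightarrow> real"
    using sum.permute[OF p, of g] by (simp add: o_def)
  have "(\<Sum>k<n. l k * c k) \<le> (\<Sum>k=1..m. (singval M k)\<^sup>2)"
    if m: "m \<le> n" and c: "\<forall>k<n. 0 \<le> c k \<and> c k \<le> 1" and total: "(\<Sum>k<n. c k) \<le> real m" for c m
  proof -
    \<comment> \<open>Reindexing by \<open>p\<close> makes the eigenvalues decreasing; the weights
      move along, which preserves their bounds and their total.\<close>
    have "(\<Sum>k<n. l k * c k) = (\<Sum>k<n. l (p k) * c (p k))"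
      by (rule perm[symmetric])
    also have "\<dots> \<le> (\<Sum>k<m. l (p k))"
    proof (rule antimono_weighted_sum_le[OF m])
      show "l (p j) \<le> l (p i)" if "i \<le> j" "j < n" for i j
        using singval_antimono[OF M that] singval_nonneg[OF M that(2)] that
        by (simp add: sq power_mono)
    qed (use l c pn perm[of c] total in auto)
    also have "\<dots> = (\<Sum>k<m. (singval M (Suc k))\<^sup>2)"
      using m by (intro sum.cong) (auto simp: sq)
    also have "\<dots> = (\<Sum>k=1..m. (singval M k)\<^sup>2)"
      by (rule sum.reindex_bij_witness[of _ "\<lambda>k. k - 1" Suc]) auto
    finally show ?thesis .
  qed
  with X D show ?thesis by blast
qed

text \<open>Column \<open>i\<close> of \<open>Z * C\<close> is the projection of the unit vector \<open>i\<close> onto the column space of \<open>Z\<close>, so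
  its entry \<open>i\<close> equals its squared norm \<open>t\<close>; hence \<open>t\<^sup>2 \<le> t\<close>.\<close>

lemma bessel_orthogonal_columns:
  fixes Z :: "complex mat" and l :: "nat \<Rightarrow> real"
  assumes Z: "Z \<in> carrier_mat n n" "mat_adjoint Z * Z = diag_fun_mat n (\<lambda>k. of_real (l k))"
    and i: "i < n"
  shows "(\<Sum>k<n. (cmod (Z $$ (i, k)))\<^sup>2 / l k) \<le> 1"
proof -
  \<comment> \<open>This is the pseudo-inverse of \<open>Z\<close>: where \<open>l k = 0\<close> the
    column \<open>k\<close> of \<open>Z\<close> is zero, and division by zero returns the right
    value 0.\<close>
  define C where "C = mat n n (\<lambda>(k, j). cnj (Z $$ (j, k)) / of_real (l k))"
  define t where "t = (\<Sum>k<n. (cmod (Z $$ (i, k)))\<^sup>2 / l k)"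
  have C: "C \<in> carrier_mat n n" by (simp add: C_def)
  have ZC: "Z * C \<in> carrier_mat n n" using Z C by simp
  have "mat_adjoint (Z * C) * (Z * C) = mat_adjoint C * (mat_adjoint Z * Z) * C"
    using Z(1) C by (simp only: mat_adjoint_mult[of _ n n _ n] assoc_mult_mat[of _ n n _ n _ n]
        mult_carrier_square mat_adjoint_carrier)
  then have "(\<Sum>k<n. (cmod ((Z * C) $$ (k, i)))\<^sup>2) = (\<Sum>k<n. l k * (cmod (C $$ (k, i)))\<^sup>2)"
    using index_adjoint_mult[OF ZC i] index_conj_diag[OF C i, of l] unfolding Z(2)
    by (simp only: of_real_eq_iff)
  also have "\<dots> = t"
    unfolding t_def using i
    by (intro sum.cong) (auto simp: C_def norm_divide power_divide power2_eq_square)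
  finally have norm: "(\<Sum>k<n. (cmod ((Z * C) $$ (k, i)))\<^sup>2) = t" .
  have "(Z * C) $$ (i, i) = of_real t"
    using Z(1) i by (simp add: C_def t_def scalar_prod_def lessThan_atLeast0 mult_cnj_cmod)
  then have "t\<^sup>2 = (cmod ((Z * C) $$ (i, i)))\<^sup>2" by (simp only: norm_of_real power2_abs)
  also have "\<dots> \<le> t"
    unfolding norm[symmetric] using i by (intro member_le_sum) auto
  finally have "t * t \<le> t * 1" by (simp only: power2_eq_square mult_1_right)
  then have "t \<le> 1" by (cases "0 < t") simp_all
  then show ?thesis by (simp only: t_def)
qed

text \<open>\<open>U\<close> drops out of the Gram matrix of N, which becomes the diagonal matrix of
  the \<open>l k\<close> conjugated by the unitary \<open>Y\<close>. The weight of
  \<open>l k\<close> is the mass of row \<open>k\<close> of \<open>Y\<close> on \<open>J\<close>: at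
  most 1 because rows of \<open>Y\<close> have norm 1, with total \<open>card J\<close> because its
  columns do.\<close>

lemma columns_norm_le_singvals:
  assumes M: "M \<in> carrier_mat n n" and U: "unitary_mat n U" and V: "unitary_mat n V"
    and J: "J \<subseteq> {..<n}" "card J \<le> m" and m: "m \<le> n"
  shows "(\<Sum>j\<in>J. \<Sum>i<n. (cmod ((mat_adjoint U * M * V) $$ (i, j)))\<^sup>2) \<le> (\<Sum>k=1..m. (singval M k)\<^sup>2)"
proof -
  from singval_weighted_sum[OF M] obtain X l where X: "unitary_mat n X"
    and D: "mat_adjoint X * (mat_adjoint M * M) * X = diag_fun_mat n (\<lambda>k. of_real (l k))"
    and le: "\<And>c m. \<lbrakk>m \<le> n; \<forall>k<n. 0 \<le> c k \<and> c k \<le> 1; (\<Sum>k<n. c k) \<le> real m\<rbrakk>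
      \<Longrightarrow> (\<Sum>k<n. l k * c k) \<le> (\<Sum>k=1..m. (singval M k)\<^sup>2)"
    by blast
  note X' = unitary_matD(1)[OF X] and U' = unitary_matD(1)[OF U] and V' = unitary_matD(1)[OF V]
  define N where "N = mat_adjoint U * M * V"
  define Y where "Y = mat_adjoint X * V"
  have N: "N \<in> carrier_mat n n" using M U' V' by (simp add: N_def)
  have Y: "unitary_mat n Y" unfolding Y_def by (intro unitary_mat_mult unitary_mat_adjoint X V)
  note Y' = unitary_matD(1)[OF Y]
  have "mat_adjoint N * N = mat_adjoint V * (mat_adjoint M * M) * V"
    unfolding N_def by (rule adjoint_mult_conj[OF U M V'])
  also have "\<dots> = mat_adjoint Y * (mat_adjoint X * (mat_adjoint M * M) * X) * Y"
    unfolding Y_def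
    by (simp only: mat_adjoint_mult[of _ n n _ n] assoc_mult_mat[of _ n n _ n _ n]
        mat_adjoint_adjoint mult_carrier_square mat_adjoint_carrier unitary_mat_cancel[where k = n, OF X] M X' V')
  finally have col: "(\<Sum>i<n. (cmod (N $$ (i, j)))\<^sup>2) = (\<Sum>k<n. l k * (cmod (Y $$ (k, j)))\<^sup>2)" if "j < n" for j
    using index_adjoint_mult[OF N that] index_conj_diag[OF Y' that, of l] unfolding D
    by (simp only: of_real_eq_iff)
  define c where "c k = (\<Sum>j\<in>J. (cmod (Y $$ (k, j)))\<^sup>2)" for k
  have "(\<Sum>j\<in>J. \<Sum>i<n. (cmod (N $$ (i, j)))\<^sup>2) = (\<Sum>j\<in>J. \<Sum>k<n. l k * (cmod (Y $$ (k, j)))\<^sup>2)"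
    by (rule sum.cong[OF refl], rule col) (use J(1) in auto)
  also have "\<dots> = (\<Sum>k<n. l k * c k)"
    unfolding c_def sum_distrib_left by (rule sum.swap)
  also have "\<dots> \<le> (\<Sum>k=1..m. (singval M k)\<^sup>2)"
  proof (rule le[OF m])
    have "c k \<le> 1" if "k < n" for k
      unfolding c_def unitary_mat_row_sum[OF Y that, symmetric]
      by (rule sum_mono2) (use J(1) in auto)
    then show "\<forall>k<n. 0 \<le> c k \<and> c k \<le> 1" by (auto simp: c_def sum_nonneg)
    have "(\<Sum>k<n. c k) = (\<Sum>j\<in>J. \<Sum>k<n. (cmod (Y $$ (k, j)))\<^sup>2)"
      unfolding c_def by (rule sum.swap)
    also have "\<dots> = real (card J)"
      using J(1) by (subst sum.cong[OF refl, of J _ "\<lambda>_. 1"]) (auto simp: unitary_mat_col_sum[OF Y])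
    finally show "(\<Sum>k<n. c k) \<le> real m" using J(2) by simp
  qed
  finally show ?thesis by (simp only: N_def)
qed

text \<open>\<open>Z\<close> links the two products: \<open>Z * mat_adjoint Z\<close> equals that of
  N, so row norms agree, while \<open>mat_adjoint Z * Z\<close> is diagonal with entries
  \<open>l k\<close>. The weight of \<open>l k\<close> is the share of column \<open>k\<close> of
  \<open>Z\<close> lying in the rows \<open>I\<close>, hence at most 1, and by Bessel's inequality
  each row adds at most 1 to the total.\<close>

lemma rows_norm_le_singvals:
  assumes M: "M \<in> carrier_mat n n" and U: "unitary_mat n U" and V: "unitary_mat n V"
    and I: "I \<subseteq> {..<n}" "card I \<le> m" and m: "m \<le> n"
  shows "(\<Sum>i\<in>I. \<Sum>j<n. (cmod ((mat_adjoint U * M * V) $$ (i, j)))\<^sup>2) \<le> (\<Sum>k=1..m. (singval M k)\<^sup>2)"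
proof -
  from singval_weighted_sum[OF M] obtain X l where X: "unitary_mat n X"
    and D: "mat_adjoint X * (mat_adjoint M * M) * X = diag_fun_mat n (\<lambda>k. of_real (l k))"
    and le: "\<And>c m. \<lbrakk>m \<le> n; \<forall>k<n. 0 \<le> c k \<and> c k \<le> 1; (\<Sum>k<n. c k) \<le> real m\<rbrakk>
      \<Longrightarrow> (\<Sum>k<n. l k * c k) \<le> (\<Sum>k=1..m. (singval M k)\<^sup>2)"
    by blast
  note X' = unitary_matD(1)[OF X] and U' = unitary_matD(1)[OF U] and V' = unitary_matD(1)[OF V]
  define N where "N = mat_adjoint U * M * V"
  define Z where "Z = mat_adjoint U * M * X"
  have N: "N \<in> carrier_mat n n" using M U' V' by (simp add: N_def)
  have Z: "Z \<in> carrier_mat n n" using M U' X' by (simp add: Z_def)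
  have ZZ: "mat_adjoint Z * Z = diag_fun_mat n (\<lambda>k. of_real (l k))"
    unfolding Z_def adjoint_mult_conj[OF U M X'] by (rule D)
  have "N * mat_adjoint N = Z * mat_adjoint Z"
    unfolding N_def Z_def
    by (simp only: mat_adjoint_mult[of _ n n _ n] assoc_mult_mat[of _ n n _ n _ n] mat_adjoint_adjoint
        mult_carrier_square mat_adjoint_carrier unitary_mat_cancel[where k = n, OF X] unitary_mat_cancel[where k = n, OF V] M X' V' U')
  then have row: "(\<Sum>j<n. (cmod (N $$ (i, j)))\<^sup>2) = (\<Sum>k<n. (cmod (Z $$ (i, k)))\<^sup>2)" if "i < n" for i
    using index_mult_adjoint[OF N that] index_mult_adjoint[OF Z that] by (simp only: of_real_eq_iff)
  have l: "l k = (\<Sum>i<n. (cmod (Z $$ (i, k)))\<^sup>2)" if "k < n" for k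
    using index_adjoint_mult[OF Z that] that unfolding ZZ
    by (simp del: of_real_sum of_real_power)
  define c where "c k = (\<Sum>i\<in>I. (cmod (Z $$ (i, k)))\<^sup>2 / l k)" for k
  \<comment> \<open>If \<open>l k = 0\<close> then the whole column \<open>k\<close> of \<open>Z\<close> vanishes, so the junk quotient \<open>0\<close> is harmless.\<close>
  have lc: "(cmod (Z $$ (i, k)))\<^sup>2 = l k * ((cmod (Z $$ (i, k)))\<^sup>2 / l k)" if "i < n" "k < n" for i k
  proof (cases "l k = 0")
    case True
    then have "(\<Sum>i<n. (cmod (Z $$ (i, k)))\<^sup>2) = 0" using l[OF that(2)] by simp
    then have "cmod (Z $$ (i, k)) = 0" using that(1) by (simp add: sum_nonneg_eq_0_iff)
    then show ?thesis by simp
  qed simp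
  have "(\<Sum>i\<in>I. \<Sum>j<n. (cmod (N $$ (i, j)))\<^sup>2) = (\<Sum>i\<in>I. \<Sum>k<n. l k * ((cmod (Z $$ (i, k)))\<^sup>2 / l k))"
  proof (rule sum.cong[OF refl])
    fix i assume "i \<in> I"
    then have i: "i < n" using I(1) by auto
    show "(\<Sum>j<n. (cmod (N $$ (i, j)))\<^sup>2) = (\<Sum>k<n. l k * ((cmod (Z $$ (i, k)))\<^sup>2 / l k))"
      unfolding row[OF i] by (rule sum.cong[OF refl], rule lc[OF i]) simp
  qed
  also have "\<dots> = (\<Sum>k<n. l k * c k)"
    unfolding c_def sum_distrib_left by (rule sum.swap)
  also have "\<dots> \<le> (\<Sum>k=1..m. (singval M k)\<^sup>2)"
  proof (rule le[OF m])
    have "c k \<le> 1" if "k < n" for k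
    proof -
      have "(\<Sum>i\<in>I. (cmod (Z $$ (i, k)))\<^sup>2) \<le> l k"
        unfolding l[OF that] by (rule sum_mono2) (use I(1) in auto)
      moreover have "0 \<le> (\<Sum>i\<in>I. (cmod (Z $$ (i, k)))\<^sup>2)" by (simp add: sum_nonneg)
      ultimately show ?thesis
        unfolding c_def sum_divide_distrib[symmetric] divide_le_eq_1 by linarith
    qed
    moreover have "0 \<le> c k" if "k < n" for k
      unfolding c_def l[OF that] by (intro sum_nonneg divide_nonneg_nonneg) auto
    ultimately show "\<forall>k<n. 0 \<le> c k \<and> c k \<le> 1" by blast
    have "(\<Sum>k<n. c k) = (\<Sum>i\<in>I. \<Sum>k<n. (cmod (Z $$ (i, k)))\<^sup>2 / l k)"
      unfolding c_def by (rule sum.swap)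
    also have "\<dots> \<le> (\<Sum>i\<in>I. 1)"
      using I(1) by (intro sum_mono bessel_orthogonal_columns[OF Z ZZ]) auto
    finally show "(\<Sum>k<n. c k) \<le> real m" using I(2) by simp
  qed
  finally show ?thesis by (simp only: N_def)
qed

section \<open>Matching distance\<close>

lemma matching_dist_list_le:
  assumes "\<tau> permutes {..<length xs}" "length xs > 0"
    and "\<And>i. i < length xs \<Longrightarrow> cmod (xs ! i - ys ! \<tau> i) < r"
  shows "matching_dist_list xs ys < r"
proof -
  have "matching_dist_list xs ys \<le> Max ((\<lambda>i. cmod (xs ! i - ys ! \<tau> i)) ` {..<length xs})"
    unfolding matching_dist_list_def
    using assms(1) by (intro Min_le) (auto simp: finite_permutations)
  also have "\<dots> < r" using assms by (subst Max_less_iff) auto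
  finally show ?thesis .
qed

lemma matching_dist_list_nonneg:
  assumes "length xs > 0"
  shows "0 \<le> matching_dist_list xs ys"
proof -
  have "0 \<le> Max ((\<lambda>i. cmod (xs ! i - ys ! \<tau> i)) ` {..<length xs})" for \<tau> :: "nat \<Rightarrow> nat"
  proof -
    have "cmod (xs ! 0 - ys ! \<tau> 0) \<le> Max ((\<lambda>i. cmod (xs ! i - ys ! \<tau> i)) ` {..<length xs})"
      using assms by (intro Max_ge) auto
    then show ?thesis using norm_ge_zero order_trans by blast
  qed
  moreover have "{\<tau>. \<tau> permutes {..<length xs}} \<noteq> {}" using permutes_id by blast
  ultimately show ?thesis
    unfolding matching_dist_list_def by (subst Min_ge_iff) (auto simp: finite_permutations)
qed

text \<open>Join \<open>i\<close> and \<open>j\<close> when their distance is strictly below the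
  matching distance. A perfect matching would be a permutation beating the minimum, so some
  \<open>I\<close> has too few neighbours, and \<open>J\<close> is taken among its
  non-neighbours.\<close>

lemma matching_dist_list_obstruction:
  assumes n: "length xs = n" "n > 0"
  shows "\<exists>I J. I \<subseteq> {..<n} \<and> J \<subseteq> {..<n} \<and> card I + card J = n + 1
    \<and> (\<forall>i\<in>I. \<forall>j\<in>J. matching_dist_list xs ys \<le> cmod (xs ! i - ys ! j))"
proof -
  define d where "d = matching_dist_list xs ys"
  define A where "A i = {j. j < n \<and> cmod (xs ! i - ys ! j) < d}" for i
  have "\<not> (\<forall>S\<subseteq>{..<n}. card S \<le> card (\<Union> (A ` S)))"
  proof
    assume "\<forall>S\<subseteq>{..<n}. card S \<le> card (\<Union> (A ` S))"
    then obtain f where f: "\<forall>i\<in>{..<n}. f i \<in> A i" "inj_on f {..<n}"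
      using hall_marriage[of "{..<n}" A] by (auto simp: A_def)
    define \<tau> where "\<tau> i = (if i < n then f i else i)" for i
    have "inj_on \<tau> {..<n}" "\<tau> ` {..<n} \<subseteq> {..<n}"
      using f by (auto simp: \<tau>_def A_def inj_on_def)
    then have "bij_betw \<tau> {..<n} {..<n}"
      by (simp add: bij_betw_def endo_inj_surj)
    then have "\<tau> permutes {..<n}" by (rule bij_imp_permutes) (simp add: \<tau>_def)
    then have "matching_dist_list xs ys < d"
      using f(1) n by (intro matching_dist_list_le[of \<tau>]) (auto simp: \<tau>_def A_def)
    then show False by (simp add: d_def)
  qed
  then obtain I where I: "I \<subseteq> {..<n}" "card (\<Union> (A ` I)) < card I" by (auto simp: not_le)
  have sub: "\<Union> (A ` I) \<subseteq> {..<n}" by (auto simp: A_def)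
  have "card I \<le> n" using I(1) card_mono[of "{..<n}" I] by simp
  moreover have "card ({..<n} - \<Union> (A ` I)) = n - card (\<Union> (A ` I))"
    using card_Diff_subset[OF finite_subset[OF sub] sub] by simp
  ultimately have "n + 1 - card I \<le> card ({..<n} - \<Union> (A ` I))" using I(2) by linarith
  \<comment> \<open>The complement may be larger. Cutting it to the exact size keeps the block mass
    at least 1 and also bounds the smaller of \<open>I\<close> and \<open>J\<close> by half of
    \<open>n + 1\<close>.\<close>
  then obtain J where J: "J \<subseteq> {..<n} - \<Union> (A ` I)" "card J = n + 1 - card I"
    by (rule obtain_subset_with_card_n)
  have "d \<le> cmod (xs ! i - ys ! j)" if "i \<in> I" "j \<in> J" for i j
    using that J(1) unfolding A_def by (auto simp: not_less)
  moreover have "card I + card J = n + 1" using J(2) \<open>card I \<le> n\<close> by simp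
  ultimately show ?thesis using I(1) J(1) unfolding d_def by blast
qed

text \<open>Using the eigenbasis of \<open>A\<close> on the left and that of \<open>B\<close> on the
  right turns the two terms into diagonal times \<open>W\<close> and \<open>W\<close> times
  diagonal, so a single difference of eigenvalues factors out of each entry.\<close>

lemma index_conj_diff:
  assumes A: "A \<in> carrier_mat n n" and B: "B \<in> carrier_mat n n"
    and U: "unitary_mat n U" and V: "unitary_mat n V"
    and a: "mat_adjoint U * A * U = diag_fun_mat n a"
    and b: "mat_adjoint V * B * V = diag_fun_mat n b"
    and ij: "i < n" "j < n"
  shows "(mat_adjoint U * (A - B) * V) $$ (i, j) = (a i - b j) * (mat_adjoint U * V) $$ (i, j)"
proof -
  note U' = unitary_matD(1)[OF U] and V' = unitary_matD(1)[OF V]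
  define W where "W = mat_adjoint U * V"
  have W: "W \<in> carrier_mat n n" using U' V' by (simp add: W_def)
  have "mat_adjoint U * A * V = mat_adjoint U * A * U * W"
    unfolding W_def by (simp only: assoc_mult_mat[of _ n n _ n _ n] mult_carrier_square
        mat_adjoint_carrier unitary_mat_cancel[where k = n, OF U] A U' V')
  then have 1: "mat_adjoint U * A * V = diag_fun_mat n a * W" by (simp only: a)
  have "mat_adjoint U * B * V = W * (mat_adjoint V * B * V)"
    unfolding W_def by (simp only: assoc_mult_mat[of _ n n _ n _ n] mult_carrier_square
        mat_adjoint_carrier unitary_mat_cancel[where k = n, OF V] B U' V')
  then have 2: "mat_adjoint U * B * V = W * diag_fun_mat n b" by (simp only: b)
  have "mat_adjoint U * (A - B) * V = (mat_adjoint U * A - mat_adjoint U * B) * V"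
    by (subst mult_minus_distrib_mat[of _ n n _ n]) (use A B U' in auto)
  also have "\<dots> = mat_adjoint U * A * V - mat_adjoint U * B * V"
    by (rule minus_mult_distrib_mat[of _ n n _ _ n]) (use A B U' V' in auto)
  also have "\<dots> = diag_fun_mat n a * W - W * diag_fun_mat n b" by (simp only: 1 2)
  also have "\<dots> $$ (i, j) = a i * W $$ (i, j) - W $$ (i, j) * b j"
    using W ij by (simp add: scalar_prod_def lessThan_atLeast0 if_distrib[of "\<lambda>x. _ * x"]
        if_distrib[of "\<lambda>x. x * _"] sum.delta cong: if_cong)
  finally show ?thesis by (simp add: W_def algebra_simps)
qed

text \<open>The rows in \<open>I\<close> have total mass \<open>card I\<close>, and the columns
  outside \<open>J\<close> can absorb at most \<open>n - card J\<close> of it.\<close>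

lemma unitary_mat_block_sum_ge:
  assumes W: "unitary_mat n W" and I: "I \<subseteq> {..<n}" and J: "J \<subseteq> {..<n}"
  shows "real (card I) + real (card J) - real n \<le> (\<Sum>i\<in>I. \<Sum>j\<in>J. (cmod (W $$ (i, j)))\<^sup>2)"
proof -
  let ?w = "\<lambda>i j. (cmod (W $$ (i, j)))\<^sup>2"
  have fin: "finite I" "finite J" using I J finite_subset by blast+
  have "real (card I) = (\<Sum>i\<in>I. \<Sum>j<n. ?w i j)"
    using I by (subst sum.cong[OF refl, of I _ "\<lambda>_. 1"]) (auto simp: unitary_mat_row_sum[OF W])
  also have "\<dots> = (\<Sum>i\<in>I. \<Sum>j\<in>J. ?w i j) + (\<Sum>i\<in>I. \<Sum>j\<in>{..<n} - J. ?w i j)"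
    by (simp add: sum.subset_diff[OF J] sum.distrib add.commute)
  also have "(\<Sum>i\<in>I. \<Sum>j\<in>{..<n} - J. ?w i j) \<le> (\<Sum>i<n. \<Sum>j\<in>{..<n} - J. ?w i j)"
    using I by (intro sum_mono2) (auto simp: sum_nonneg)
  also have "\<dots> = (\<Sum>j\<in>{..<n} - J. \<Sum>i<n. ?w i j)" by (rule sum.swap)
  also have "\<dots> = real (card ({..<n} - J))"
    by (subst sum.cong[OF refl, of "{..<n} - J" _ "\<lambda>_. 1"]) (auto simp: unitary_mat_col_sum[OF W])
  also have "\<dots> = real n - real (card J)"
    using card_Diff_subset[OF fin(2) J] card_mono[OF _ J] by simp
  finally show ?thesis by simp
qed

lemma opt_matching_dist_normal_le:
  assumes n: "n \<ge> 1" and A: "A \<in> carrier_mat n n" "normal_mat A"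
    and B: "B \<in> carrier_mat n n" "normal_mat B"
  shows "(opt_matching_dist (eigvals A) (eigvals B))\<^sup>2
      \<le> (\<Sum>k=1..(n + 1) div 2. (singval (A - B) k)\<^sup>2)"
    and "0 \<le> opt_matching_dist (eigvals A) (eigvals B)"
proof -
  from normal_mat_unitary_diagonalization[OF A] obtain U a where U: "unitary_mat n U"
    and a: "mat_adjoint U * A * U = diag_fun_mat n a" by blast
  from normal_mat_unitary_diagonalization[OF B] obtain V b where V: "unitary_mat n V"
    and b: "mat_adjoint V * B * V = diag_fun_mat n b" by blast
  let ?xs = "map a [0..<n]" and ?ys = "map b [0..<n]"
  define d where "d = matching_dist_list ?xs ?ys"
  \<comment> \<open>The matching distance does not depend on the enumerations, so the diagonals
    themselves may be used, and \<open>I\<close> and \<open>J\<close> become sets of row and column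
    indices of N.\<close>
  have dist: "opt_matching_dist (eigvals A) (eigvals B) = d"
    unfolding d_def by (rule opt_matching_dist_eq)
      (simp_all add: eigvals_unitary_diagonalization[OF A(1) U a] eigvals_unitary_diagonalization[OF B(1) V b])
  have d0: "0 \<le> d" unfolding d_def by (rule matching_dist_list_nonneg) (use n in simp)
  then show "0 \<le> opt_matching_dist (eigvals A) (eigvals B)" by (simp only: dist)
  let ?m = "(n + 1) div 2"
  have m: "?m \<le> n" using n by linarith
  from matching_dist_list_obstruction[of ?xs n ?ys] n obtain I J where
    IJ: "I \<subseteq> {..<n}" "J \<subseteq> {..<n}" "card I + card J = n + 1"
    and far': "\<forall>i\<in>I. \<forall>j\<in>J. d \<le> cmod (?xs ! i - ?ys ! j)"
    unfolding d_def by auto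
  have far: "d \<le> cmod (a i - b j)" if "i \<in> I" "j \<in> J" for i j
  proof -
    have "i < n" "j < n" using that IJ by auto
    with far' that show ?thesis by fastforce
  qed
  define W where "W = mat_adjoint U * V"
  have W: "unitary_mat n W" unfolding W_def by (intro unitary_mat_mult unitary_mat_adjoint U V)
  define N where "N = mat_adjoint U * (A - B) * V"
  have AB: "A - B \<in> carrier_mat n n" using B(1) by (rule minus_carrier_mat)
  have "d\<^sup>2 * 1 \<le> d\<^sup>2 * (\<Sum>i\<in>I. \<Sum>j\<in>J. (cmod (W $$ (i, j)))\<^sup>2)"
    using unitary_mat_block_sum_ge[OF W IJ(1,2)] IJ(3) by (intro mult_left_mono) auto
  also have "\<dots> = (\<Sum>i\<in>I. \<Sum>j\<in>J. d\<^sup>2 * (cmod (W $$ (i, j)))\<^sup>2)"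
    by (simp only: sum_distrib_left)
  also have "\<dots> \<le> (\<Sum>i\<in>I. \<Sum>j\<in>J. (cmod (N $$ (i, j)))\<^sup>2)"
  proof (intro sum_mono)
    fix i j assume ij: "i \<in> I" "j \<in> J"
    then have "N $$ (i, j) = (a i - b j) * W $$ (i, j)"
      unfolding N_def W_def using IJ(1,2) by (intro index_conj_diff[OF A(1) B(1) U V a b]) auto
    then have "(cmod (N $$ (i, j)))\<^sup>2 = (cmod (a i - b j))\<^sup>2 * (cmod (W $$ (i, j)))\<^sup>2"
      by (simp only: norm_mult power_mult_distrib)
    \<comment> \<open>Squaring the lower bound on the distance relies on \<open>d\<close> being
      nonnegative.\<close>
    moreover have "d\<^sup>2 \<le> (cmod (a i - b j))\<^sup>2" using far[OF ij] d0 by (rule power_mono)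
    ultimately show "d\<^sup>2 * (cmod (W $$ (i, j)))\<^sup>2 \<le> (cmod (N $$ (i, j)))\<^sup>2"
      by (simp add: mult_right_mono)
  qed
  also have "\<dots> \<le> (\<Sum>k=1..?m. (singval (A - B) k)\<^sup>2)"
  proof (cases "card I \<le> ?m")
    case True
    have "(\<Sum>i\<in>I. \<Sum>j\<in>J. (cmod (N $$ (i, j)))\<^sup>2) \<le> (\<Sum>i\<in>I. \<Sum>j<n. (cmod (N $$ (i, j)))\<^sup>2)"
      using IJ(2) by (intro sum_mono sum_mono2) auto
    also have "\<dots> \<le> (\<Sum>k=1..?m. (singval (A - B) k)\<^sup>2)"
      unfolding N_def by (rule rows_norm_le_singvals[OF AB U V IJ(1) True m])
    finally show ?thesis .
  next
    case False
    then have J: "card J \<le> ?m" using IJ(3) by linarith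
    have "(\<Sum>i\<in>I. \<Sum>j\<in>J. (cmod (N $$ (i, j)))\<^sup>2) = (\<Sum>j\<in>J. \<Sum>i\<in>I. (cmod (N $$ (i, j)))\<^sup>2)"
      by (rule sum.swap)
    also have "\<dots> \<le> (\<Sum>j\<in>J. \<Sum>i<n. (cmod (N $$ (i, j)))\<^sup>2)"
      using IJ(1) by (intro sum_mono sum_mono2) auto
    also have "\<dots> \<le> (\<Sum>k=1..?m. (singval (A - B) k)\<^sup>2)"
      unfolding N_def by (rule columns_norm_le_singvals[OF AB U V IJ(2) J m])
    finally show ?thesis .
  qed
  finally show "(opt_matching_dist (eigvals A) (eigvals B))\<^sup>2 \<le> (\<Sum>k=1..?m. (singval (A - B) k)\<^sup>2)"
    by (simp only: dist mult_1_right)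
qed

theorem theorem1p1:
  fixes n m :: nat and A B :: "complex mat"
  assumes "n \<ge> 1"
    and "m = (n + 1) div 2"
    and "A \<in> carrier_mat n n" and "B \<in> carrier_mat n n"
    and "normal_mat A" and "normal_mat B"
  shows "(opt_matching_dist (eigvals A) (eigvals B))\<^sup>2 \<le> (\<Sum>k=1..m. (singval (A - B) k)\<^sup>2)
    \<and> opt_matching_dist (eigvals A) (eigvals B) \<le> ky_fan2_norm m (A - B)
    \<and> opt_matching_dist (eigvals A) (eigvals B) \<le> sqrt (real m) * spectral_norm (A - B)"
proof (intro conjI)
  let ?d = "opt_matching_dist (eigvals A) (eigvals B)" and ?S = "\<Sum>k=1..m. (singval (A - B) k)\<^sup>2"
  have AB: "A - B \<in> carrier_mat n n" using assms(4) by (rule minus_carrier_mat)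
  have m: "m \<le> n" using assms(1,2) by linarith
  note bound = opt_matching_dist_normal_le[OF assms(1,3,5,4,6), folded assms(2)]
  show "?d\<^sup>2 \<le> ?S" by (rule bound(1))
  then have le: "?d \<le> sqrt ?S" by (rule real_le_rsqrt)
  then show "?d \<le> ky_fan2_norm m (A - B)" by (simp only: ky_fan2_norm_def)
  \<comment> \<open>\<open>singval\<close> counts from 1 while the order lemmas speak of
    \<open>Suc\<close>, hence the instance at \<open>k - 1\<close>, which is exact because
    \<open>k\<close> is at least 1.\<close>
  have "(singval (A - B) k)\<^sup>2 \<le> (singval (A - B) 1)\<^sup>2" if "k \<in> {1..m}" for k
    using singval_antimono[OF AB, of 0 "k - 1"] singval_nonneg[OF AB, of "k - 1"] that m
    by (intro power_mono) auto
  from sum_mono[of "{1..m}", OF this] have "?S \<le> real m * (singval (A - B) 1)\<^sup>2" by simp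
  then have "sqrt ?S \<le> sqrt (real m * (singval (A - B) 1)\<^sup>2)" by (rule real_sqrt_le_mono)
  also have "\<dots> = sqrt (real m) * spectral_norm (A - B)"
    using singval_nonneg[OF AB, of 0] assms(1) by (simp add: real_sqrt_mult spectral_norm_def)
  finally show "?d \<le> sqrt (real m) * spectral_norm (A - B)" using le by linarith
qed

end
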